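(* There is a randomized $\frac12$-approximation for maximizing a nonnegative DR-submodular function on a distributive lattice (DR-SMDL): there is a randomized algorithm which, given a finite poset $P=(\mathcal{N},\preceq)$ and a value oracle for a DR-submodular function $f:\mathcal{D}(P)\to\mathbb{R}_+$, runs in time polynomial in $|\mathcal{N}|$ (counting oracle calls as single steps) and outputs a random ideal $A\in\mathcal{D}(P)$ with $E[f(A)]\ge\frac12\max\{f(S):S\in\mathcal{D}(P)\}$.
   Context: For a finite poset $P=(\mathcal{N},\preceq)$, an ideal is a set $S\subseteq\mathcal{N}$ such that $s\in S$ and $t\preceq s$ imply $t\in S$; $\mathcal{D}(P)$ is the set of all ideals of $P$, a distributive lattice under union and intersection (by Birkhoff's theorem every finite distributive lattice is of this form, and the lattice is assumed to be given by $P$). Write $S+x=S\cup\{x\}$. A function $f:\mathcal{D}(P)\to\mathbb{R}_+$ is DR-submodular if $f(S+x)-f(S)\ge f(T+y)-f(T)$ for all $S,T\in\mathcal{D}(P)$ with $S\subseteq T$ and all $x\preceq y$ with $x\notin S$, $y\notin T$, $S+x\in\mathcal{D}(P)$ and $T+y\in\mathcal{D}(P)$. *)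

theory Defs
  imports "HOL-Probability.Probability" "HOL-Computational_Algebra.Polynomial"
begin

section \<open>DR-submodular functions on the lattice of ideals of a poset\<close>

definition ideals :: "'a set \<Rightarrow> ('a \<times> 'a) set \<Rightarrow> 'a set set" where
  "ideals N r = {S. S \<subseteq> N \<and> (\<forall>s\<in>S. \<forall>t\<in>N. (t, s) \<in> r \<longrightarrow> t \<in> S)}"

text \<open>Only the values of \<open>f\<close> on ideals are constrained; its values on other sets are arbitrary.\<close>

definition dr_submodular :: "'a set \<Rightarrow> ('a \<times> 'a) set \<Rightarrow> ('a set \<Rightarrow> real) \<Rightarrow> bool" where
  "dr_submodular N r f \<longleftrightarrow>
    (\<forall>S\<in>ideals N r. \<forall>T\<in>ideals N r. \<forall>x y.
      S \<subseteq> T \<and> (x, y) \<in> r \<and> x \<notin> S \<and> y \<notin> T \<and>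
      insert x S \<in> ideals N r \<and> insert y T \<in> ideals N r \<longrightarrow>
        f (insert x S) - f S \<ge> f (insert y T) - f T)"

section \<open>Randomized oracle programs\<close>

text \<open>
  Algorithms are programs of a small imperative language over a random access memory with
  natural-number arrays and real arrays; a scalar variable is an array used at index 0 only.
  The problem instance is read-only: a size \<open>n\<close>, a relation \<open>r\<close> on \<open>{..<n}\<close>, available through
  the test \<open>Below\<close>, and a set function \<open>f\<close>, available through the command \<open>Query\<close>.

  One computation step evaluates boundedly many operators (the bound depends on the program only).
  The operators on naturals are addition and truncated subtraction, so that the bit length of
  every stored natural grows by at most a constant per step. Reals are exact, as in the real RAM
  (Blum--Shub--Smale) model: the field operations and comparison, but no rounding and no real
  constants other than integers. Division by zero yields zero.
\<close>

datatype nexp =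
    Num nat
  | Size
  | NGet nat nexp
  | NAdd nexp nexp
  | NSub nexp nexp

datatype rexp =
    RNum int
  | RGet nat nexp
  | RAdd rexp rexp
  | RSub rexp rexp
  | RMul rexp rexp
  | RDiv rexp rexp

datatype bexp =
    Below nexp nexp
  | NLess nexp nexp
  | RLess rexp rexp
  | Neg bexp
  | Conj bexp bexp

text \<open>
  \<open>Query x i a\<close> stores, in cell \<open>i\<close> of the real array \<open>x\<close>, the value of \<open>f\<close> at the set
  whose characteristic vector is held in the array \<open>a\<close>.
  \<open>Flip x i p\<close> stores the outcome (1 or 0) of a coin of bias \<open>p\<close>, independent of all
  previous ones, in cell \<open>i\<close> of the array \<open>x\<close>.
\<close>

datatype com =
    Skip
  | NSet nat nexp nexp
  | RSet nat nexp rexp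
  | Query nat nexp nat
  | Flip nat nexp rexp
  | Seq com com
  | Cond bexp com com
  | While bexp com

record state =
  nats :: "nat \<Rightarrow> nat \<Rightarrow> nat"
  reals :: "nat \<Rightarrow> nat \<Rightarrow> real"

definition init_state :: state where
  "init_state = \<lparr>nats = (\<lambda>_ _. 0), reals = (\<lambda>_ _. 0)\<rparr>"

definition set_nat :: "nat \<Rightarrow> nat \<Rightarrow> nat \<Rightarrow> state \<Rightarrow> state" where
  "set_nat x i v s = s\<lparr>nats := (nats s)(x := (nats s x)(i := v))\<rparr>"

definition set_real :: "nat \<Rightarrow> nat \<Rightarrow> real \<Rightarrow> state \<Rightarrow> state" where
  "set_real x i v s = s\<lparr>reals := (reals s)(x := (reals s x)(i := v))\<rparr>"

definition stored_set :: "nat \<Rightarrow> nat \<Rightarrow> state \<Rightarrow> nat set" where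
  "stored_set n a s = {i. i < n \<and> nats s a i \<noteq> 0}"

primrec nval :: "nat \<Rightarrow> nexp \<Rightarrow> state \<Rightarrow> nat" where
  "nval n (Num k) s = k"
| "nval n Size s = n"
| "nval n (NGet x e) s = nats s x (nval n e s)"
| "nval n (NAdd e1 e2) s = nval n e1 s + nval n e2 s"
| "nval n (NSub e1 e2) s = nval n e1 s - nval n e2 s"

primrec rval :: "nat \<Rightarrow> rexp \<Rightarrow> state \<Rightarrow> real" where
  "rval n (RNum k) s = of_int k"
| "rval n (RGet x e) s = reals s x (nval n e s)"
| "rval n (RAdd e1 e2) s = rval n e1 s + rval n e2 s"
| "rval n (RSub e1 e2) s = rval n e1 s - rval n e2 s"
| "rval n (RMul e1 e2) s = rval n e1 s * rval n e2 s"
| "rval n (RDiv e1 e2) s = rval n e1 s / rval n e2 s"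

primrec bval :: "nat \<Rightarrow> (nat \<times> nat) set \<Rightarrow> bexp \<Rightarrow> state \<Rightarrow> bool" where
  "bval n r (Below e1 e2) s \<longleftrightarrow> (nval n e1 s, nval n e2 s) \<in> r"
| "bval n r (NLess e1 e2) s \<longleftrightarrow> nval n e1 s < nval n e2 s"
| "bval n r (RLess e1 e2) s \<longleftrightarrow> rval n e1 s < rval n e2 s"
| "bval n r (Neg b) s \<longleftrightarrow> \<not> bval n r b s"
| "bval n r (Conj b1 b2) s \<longleftrightarrow> bval n r b1 s \<and> bval n r b2 s"

text \<open>
  A configuration consists of the remaining program and the memory; \<open>Skip\<close> is the halted
  program. Note that \<open>bernoulli_pmf\<close> clamps its argument to the unit interval.
\<close>

primrec step ::
  "nat \<Rightarrow> (nat \<times> nat) set \<Rightarrow> (nat set \<Rightarrow> real) \<Rightarrow> com \<Rightarrow> state \<Rightarrow> (com \<times> state) pmf" where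
  "step n r f Skip s = return_pmf (Skip, s)"
| "step n r f (NSet x i e) s = return_pmf (Skip, set_nat x (nval n i s) (nval n e s) s)"
| "step n r f (RSet x i e) s = return_pmf (Skip, set_real x (nval n i s) (rval n e s) s)"
| "step n r f (Query x i a) s =
     return_pmf (Skip, set_real x (nval n i s) (f (stored_set n a s)) s)"
| "step n r f (Flip x i p) s =
     map_pmf (\<lambda>b. (Skip, set_nat x (nval n i s) (if b then 1 else 0) s))
       (bernoulli_pmf (rval n p s))"
| "step n r f (Seq c1 c2) s =
     (if c1 = Skip then return_pmf (c2, s)
      else map_pmf (\<lambda>(c1', s'). (Seq c1' c2, s')) (step n r f c1 s))"
| "step n r f (Cond b c1 c2) s = return_pmf (if bval n r b s then c1 else c2, s)"
| "step n r f (While b c) s =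
     return_pmf (if bval n r b s then Seq c (While b c) else Skip, s)"

definition run ::
  "nat \<Rightarrow> (nat \<times> nat) set \<Rightarrow> (nat set \<Rightarrow> real) \<Rightarrow> com \<Rightarrow> nat \<Rightarrow> (com \<times> state) pmf" where
  "run n r f c t =
     ((\<lambda>D. bind_pmf D (\<lambda>(c', s). step n r f c' s)) ^^ t) (return_pmf (c, init_state))"

text \<open>Worst-case running time: every computation path has halted after \<open>t\<close> steps.\<close>

definition halts_within ::
  "nat \<Rightarrow> (nat \<times> nat) set \<Rightarrow> (nat set \<Rightarrow> real) \<Rightarrow> com \<Rightarrow> nat \<Rightarrow> bool" where
  "halts_within n r f c t \<longleftrightarrow> (\<forall>(c', s) \<in> set_pmf (run n r f c t). c' = Skip)"

text \<open>
  The output is the set held in array 0. As \<open>Skip\<close> steps to itself, this is the distribution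
  of the final output whenever the program halts within \<open>t\<close> steps.
\<close>

definition output_pmf ::
  "nat \<Rightarrow> (nat \<times> nat) set \<Rightarrow> (nat set \<Rightarrow> real) \<Rightarrow> com \<Rightarrow> nat \<Rightarrow> nat set pmf" where
  "output_pmf n r f c t = map_pmf (\<lambda>(_, s). stored_set n 0 s) (run n r f c t)"

end

theory Submission
  imports Defs
begin

text \<open>
  The algorithm is a double greedy on intervals \<open>X \<subseteq> Y\<close> of ideals, started at the full interval.
  While \<open>X \<noteq> Y\<close> it picks a minimal \<open>u\<close> and a maximal \<open>v\<close> of \<open>Y - X\<close> with \<open>u \<preceq> v\<close>, and either adds
  \<open>u\<close> to \<open>X\<close> or removes \<open>v\<close> from \<open>Y\<close>, with probabilities proportional to the positive parts of
  the gains \<open>a = f (X + u) - f X\<close> and \<open>b = f (Y - v) - f Y\<close>. An optimal ideal \<open>T\<close> is carried along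
  between \<open>X\<close> and \<open>Y\<close>, as \<open>T + u\<close> or \<open>T - v\<close>. The DR inequality for \<open>u \<preceq> v\<close> gives
  \<open>a + b \<ge> 0\<close> and bounds the loss of \<open>f T\<close> by \<open>b\<close> if \<open>u \<notin> T\<close> is added and by \<open>a\<close> if \<open>v \<in> T\<close> is
  removed; as \<open>T\<close> is an ideal, only one of the two can occur. Hence
  \<open>f X + f Y + 2 f T\<close> does not decrease in expectation; it is at least twice the optimum at the
  start and \<open>4 f X\<close> at the end.

  One pass over the ground set finds \<open>u\<close> and \<open>v\<close>: both start at the same element of \<open>Y - X\<close>, and
  every element met below \<open>u\<close> replaces \<open>u\<close>, every one above \<open>v\<close> replaces \<open>v\<close>.
\<close>

section \<open>Ideals of a finite poset\<close>

lemma partial_order_onD: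
  assumes "partial_order_on A r"
  shows "a \<in> A \<Longrightarrow> (a, a) \<in> r"
    and "(a, b) \<in> r \<Longrightarrow> (b, c) \<in> r \<Longrightarrow> (a, c) \<in> r"
    and "(a, b) \<in> r \<Longrightarrow> (b, a) \<in> r \<Longrightarrow> a = b"
  using assms unfolding partial_order_on_def preorder_on_def
  by (auto dest: refl_onD transD antisymD)

lemma finite_ideals: "finite N \<Longrightarrow> finite (ideals N r)"
  by (rule finite_subset[of _ "Pow N"]) (auto simp: ideals_def)

lemma empty_in_ideals: "{} \<in> ideals N r"
  and ground_in_ideals: "N \<in> ideals N r"
  by (auto simp: ideals_def)

text \<open>An element of \<open>N\<close> below \<open>u\<close> lies in \<open>Y\<close>, since
  \<open>Y\<close> is an ideal. It is either in \<open>X\<close>, hence in \<open>T\<close>, or in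
  \<open>Y - X\<close>, where minimality identifies it with \<open>u\<close>.\<close>

lemma ideals_insert_minimal:
  assumes "Y \<in> ideals N r" "T \<in> ideals N r" "X \<subseteq> T" "u \<in> Y"
    and "\<And>j. j \<in> Y - X \<Longrightarrow> (j, u) \<in> r \<Longrightarrow> j = u"
  shows "insert u T \<in> ideals N r"
  using assms unfolding ideals_def by blast

text \<open>If \<open>v\<close> is below some \<open>s\<close> in \<open>T\<close>, then
  \<open>s\<close> is not in \<open>X\<close>, since otherwise the ideal \<open>X\<close> would
  contain \<open>v\<close>. So \<open>s\<close> is in \<open>Y - X\<close>, and maximality forces
  \<open>s = v\<close>.\<close>

lemma ideals_remove_maximal:
  assumes "X \<in> ideals N r" "T \<in> ideals N r" "T \<subseteq> Y" "v \<in> Y - X"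
    and "\<And>j. j \<in> Y - X \<Longrightarrow> (v, j) \<in> r \<Longrightarrow> j = v"
  shows "T - {v} \<in> ideals N r"
  using assms unfolding ideals_def by blast

section \<open>The biased coin\<close>

definition clamp_unit :: "real \<Rightarrow> real" where
  "clamp_unit q = min 1 (max 0 q)"

lemma clamp_unit_bounds: "0 \<le> clamp_unit q" "clamp_unit q \<le> 1"
  by (simp_all add: clamp_unit_def)

lemma bernoulli_pmf_clamp_unit: "bernoulli_pmf (clamp_unit q) = bernoulli_pmf q"
  by (rule pmf_eqI) (simp add: bernoulli_pmf.rep_eq clamp_unit_def)

text \<open>\<open>bernoulli_pmf\<close> truncates its parameter, so the weights are those of the
  clamped bias. Finite supports let the expectation split over the two outcomes.\<close>

lemma expectation_bind_bernoulli:
  fixes g :: "'a \<Rightarrow> real"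
  assumes "\<And>b. finite (set_pmf (K b))"
  shows "measure_pmf.expectation (bind_pmf (bernoulli_pmf q) K) g =
    clamp_unit q * measure_pmf.expectation (K True) g +
    (1 - clamp_unit q) * measure_pmf.expectation (K False) g"
proof -
  have "measure_pmf.expectation (bind_pmf (bernoulli_pmf (clamp_unit q)) K) g =
      (\<Sum>b\<in>UNIV. pmf (bernoulli_pmf (clamp_unit q)) b *\<^sub>R measure_pmf.expectation (K b) g)"
    by (rule pmf_expectation_bind) (simp_all add: assms)
  then show ?thesis
    by (simp add: clamp_unit_bounds UNIV_bool) (simp add: bernoulli_pmf_clamp_unit)
qed

text \<open>
  The coin of the double greedy algorithm: the expected gain pays twice for the expected loss,
  which is at most \<open>b\<close> on heads, or at most \<open>a\<close> on tails. When \<open>a = b = 0\<close> the quotient is \<open>0 / 0 = 0\<close>.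
\<close>

lemma greedy_coin:
  fixes a b :: real
  defines "p \<equiv> clamp_unit (a / (a + max b 0))"
  assumes "0 \<le> a + b"
  shows "2 * p * b \<le> p * a + (1 - p) * b" "2 * (1 - p) * a \<le> p * a + (1 - p) * b"
    "0 \<le> p * a + (1 - p) * b"
proof -
  consider "a \<le> 0" | "0 < a" "b \<le> 0" | "0 < a" "0 < b"
    by linarith
  then have "2 * p * b \<le> p * a + (1 - p) * b \<and> 2 * (1 - p) * a \<le> p * a + (1 - p) * b \<and>
    0 \<le> p * a + (1 - p) * b"
  proof cases
    case 1
    then have "a / (a + max b 0) \<le> 0"
      using assms(2) by (intro divide_nonpos_nonneg) auto
    then have "p = 0"
      by (simp add: p_def clamp_unit_def)
    then show ?thesis
      using 1 assms(2) by simp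
  next
    case 2
    then have "p = 1"
      by (simp add: p_def clamp_unit_def)
    then show ?thesis
      using 2 by simp
  next
    case 3
    then have p: "p = a / (a + b)"
      by (simp add: p_def clamp_unit_def)
    then have q: "1 - p = b / (a + b)"
      using 3 by (simp add: field_simps)
    have "2 * a * b \<le> a * a + b * b"
      using sum_squares_bound[of a b] by (simp add: power2_eq_square)
    then have "2 * a * b / (a + b) \<le> (a * a + b * b) / (a + b)"
      using 3 by (intro divide_right_mono) auto
    moreover have "p * a + (1 - p) * b = (a * a + b * b) / (a + b)"
      "2 * p * b = 2 * a * b / (a + b)" "2 * (1 - p) * a = 2 * a * b / (a + b)"
      unfolding q by (simp_all add: p add_divide_distrib)
    moreover have "0 \<le> 2 * a * b / (a + b)"
      using 3 by simp
    ultimately show ?thesis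
      by linarith
  qed
  then show "2 * p * b \<le> p * a + (1 - p) * b" "2 * (1 - p) * a \<le> p * a + (1 - p) * b"
    "0 \<le> p * a + (1 - p) * b"
    by auto
qed

section \<open>The potential and its expected growth\<close>

definition potential :: "('a set \<Rightarrow> real) \<Rightarrow> 'a set \<Rightarrow> 'a set \<Rightarrow> 'a set \<Rightarrow> real" where
  "potential f X Y T = f X + f Y + 2 * f T"

lemma potential_step:
  fixes f :: "'a set \<Rightarrow> real"
  defines "p X Y u v \<equiv> clamp_unit ((f (insert u X) - f X) /
    (f (insert u X) - f X + max (f (Y - {v}) - f Y) 0))"
  assumes dr: "dr_submodular N r f"
    and ideals: "X \<in> ideals N r" "Y \<in> ideals N r" "T \<in> ideals N r"
    and between: "X \<subseteq> T" "T \<subseteq> Y"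
    and uv: "u \<in> Y - X" "v \<in> Y - X" "(u, v) \<in> r"
    and minimal: "\<And>j. j \<in> Y - X \<Longrightarrow> (j, u) \<in> r \<Longrightarrow> j = u"
    and maximal: "\<And>j. j \<in> Y - X \<Longrightarrow> (v, j) \<in> r \<Longrightarrow> j = v"
  shows "potential f X Y T \<le> p X Y u v * potential f (insert u X) Y (insert u T) +
    (1 - p X Y u v) * potential f X (Y - {v}) (T - {v})"
proof -
  define a where "a = f (insert u X) - f X"
  define b where "b = f (Y - {v}) - f Y"
  define q where "q = p X Y u v"
  note insert_ideal = ideals_insert_minimal[OF ideals(2) _ _ _ minimal]
  note remove_ideal = ideals_remove_maximal[OF ideals(1) _ _ uv(2) maximal]
  have dr: "f (insert y T') - f T' \<le> f (insert x S) - f S"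
    if "S \<in> ideals N r" "T' \<in> ideals N r" "S \<subseteq> T'" "(x, y) \<in> r" "x \<notin> S" "y \<notin> T'"
      "insert x S \<in> ideals N r" "insert y T' \<in> ideals N r" for S T' x y
    using dr that unfolding dr_submodular_def by blast
  have Xu: "insert u X \<in> ideals N r" and Tu: "insert u T \<in> ideals N r"
    using insert_ideal ideals between uv by blast+
  have Yv: "Y - {v} \<in> ideals N r" and Tv: "T - {v} \<in> ideals N r"
    using remove_ideal ideals between by blast+
  have ins: "insert v (Y - {v}) = Y"
    using uv by auto
  \<comment> \<open>Here and in \<open>loss_u\<close>, DR compares adding \<open>u\<close> to
    \<open>X\<close> or \<open>T\<close> with adding \<open>v\<close> to \<open>Y - {v}\<close>, a
    move that gains \<open>-b\<close>. In \<open>loss_v\<close> it compares adding \<open>u\<close>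
    to \<open>X\<close> with adding \<open>v\<close> to \<open>T - {v}\<close>.\<close>
  have nonneg: "0 \<le> a + b"
    using dr[OF ideals(1) Yv _ uv(3) _ _ Xu] ideals between uv
    unfolding ins a_def b_def by fastforce
  have loss_u: "f T - f (insert u T) \<le> b" if "u \<notin> T"
  proof -
    have "v \<notin> T"
      using that uv ideals unfolding ideals_def by blast
    then show ?thesis
      using dr[OF ideals(3) Yv _ uv(3) that _ Tu] ideals between unfolding ins b_def by fastforce
  qed
  have loss_v: "f T - f (T - {v}) \<le> a" if "v \<in> T"
    using dr[of X "T - {v}" u v] that ideals between uv Xu Tv
    by (auto simp: insert_absorb a_def)
  have q: "0 \<le> q" "0 \<le> 1 - q"
    by (simp_all add: q_def p_def clamp_unit_bounds)
  have q_eq: "q = clamp_unit (a / (a + max b 0))"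
    by (simp add: q_def p_def a_def b_def)
  \<comment> \<open>Twice the expected loss of \<open>f T\<close> against the expected gain of
    \<open>f X + f Y\<close>; the difference is the expected growth of the potential.\<close>
  have "2 * q * (f T - f (insert u T)) + 2 * (1 - q) * (f T - f (T - {v}))
      \<le> q * a + (1 - q) * b"
  proof (cases "u \<in> T")
    case u: True
    then have [simp]: "insert u T = T"
      by auto
    show ?thesis
    proof (cases "v \<in> T")
      case True
      then have "(1 - q) * (f T - f (T - {v})) \<le> (1 - q) * a"
        using loss_v q by (intro mult_left_mono) auto
      then show ?thesis
        using greedy_coin(2)[OF nonneg] by (simp add: q_eq[symmetric] algebra_simps)
    next
      case False
      then show ?thesis
        using greedy_coin(3)[OF nonneg] by (simp add: q_eq[symmetric])
    qed
  next
    case False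
    then have v: "v \<notin> T"
      using uv ideals unfolding ideals_def by blast
    have "q * (f T - f (insert u T)) \<le> q * b"
      using loss_u[OF False] q by (intro mult_left_mono) auto
    then show ?thesis
      using v greedy_coin(1)[OF nonneg] by (simp add: q_eq[symmetric])
  qed
  then show ?thesis
    unfolding q_def[symmetric] by (simp add: potential_def a_def b_def algebra_simps)
qed

section \<open>Distributions of program runs\<close>

locale oracle_machine =
  fixes n :: nat and r :: "(nat \<times> nat) set" and f :: "nat set \<Rightarrow> real"
begin

text \<open>Unlike \<open>run\<close>, this recursion peels off the first step and starts from any
  configuration, as the composition rules for programs require.\<close>

primrec exec :: "nat \<Rightarrow> com \<times> state \<Rightarrow> (com \<times> state) pmf" where
  "exec 0 cs = return_pmf cs"
| "exec (Suc t) cs = bind_pmf (step n r f (fst cs) (snd cs)) (exec t)"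

lemma exec_0: "exec 0 = return_pmf"
  by (rule ext) simp

lemma exec_Skip: "exec t (Skip, s) = return_pmf (Skip, s)"
  by (induction t) (simp_all add: bind_return_pmf)

lemma exec_add: "exec (t + t') cs = bind_pmf (exec t cs) (exec t')"
proof (induction t arbitrary: cs)
  case (Suc t)
  then show ?case by (simp add: bind_assoc_pmf cong: bind_pmf_cong)
qed (simp add: bind_return_pmf)

lemma run_eq_exec: "run n r f c t = exec t (c, init_state)"
proof -
  let ?K = "\<lambda>D. bind_pmf D (\<lambda>(c', s). step n r f c' s)"
  have "(?K ^^ t) D = bind_pmf D (exec t)" for D
  proof (induction t arbitrary: D)
    case 0
    then show ?case by (simp only: exec_0 bind_return_pmf' funpow_0)
  next
    case (Suc t)
    have "(?K ^^ Suc t) D = (?K ^^ t) (?K D)"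
      by (simp only: funpow_Suc_right o_apply)
    also have "\<dots> = bind_pmf D (\<lambda>cs. bind_pmf (step n r f (fst cs) (snd cs)) (exec t))"
      unfolding Suc bind_assoc_pmf by (simp only: case_prod_beta)
    finally show ?case
      by (simp cong: bind_pmf_cong)
  qed
  then show ?thesis
    by (simp add: run_def bind_return_pmf)
qed

text \<open>As \<open>Skip\<close> steps to itself, \<open>t\<close> is an upper bound on the
  running time, and one equation carries both termination on all paths and the output law.\<close>

definition computes :: "com \<Rightarrow> state \<Rightarrow> nat \<Rightarrow> state pmf \<Rightarrow> bool" where
  "computes c s t M \<longleftrightarrow> exec t (c, s) = map_pmf (Pair Skip) M"

lemma map_Pair_Skip_eq_return:
  "map_pmf (Pair Skip) M = return_pmf (c, s) \<longleftrightarrow> c = Skip \<and> M = return_pmf s"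
  unfolding map_pmf_eq_return_pmf_iff set_pmf_subset_singleton[symmetric]
  using set_pmf_not_empty[of M] by auto

lemma computes_mono:
  assumes "computes c s t M" "t \<le> t'"
  shows "computes c s t' M"
proof -
  have "exec (t + (t' - t)) (c, s) = map_pmf (Pair Skip) M"
    using assms(1) by (simp add: exec_add computes_def bind_map_pmf exec_Skip)
      (simp add: map_pmf_def)
  then show ?thesis
    using assms(2) by (simp add: computes_def)
qed

lemma computes_Skip: "computes Skip s t (return_pmf s)"
  by (simp add: computes_def exec_Skip)

lemma computes_step:
  assumes "step n r f c s = map_pmf (Pair Skip) M"
  shows "computes c s 1 M"
  using assms by (simp add: computes_def exec_0 bind_return_pmf')

text \<open>Paths of \<open>c1\<close> may halt at different times. The induction follows the first
  step of \<open>c1\<close>, so every path switches to \<open>c2\<close> when it is ready; time left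
  over goes to \<open>c2\<close>, and the extra step discards the finished
  \<open>Skip\<close>.\<close>

lemma computes_Seq:
  assumes "computes c1 s t1 M" "\<And>s'. s' \<in> set_pmf M \<Longrightarrow> computes c2 s' t2 (K s')"
  shows "computes (Seq c1 c2) s (t1 + t2 + 1) (bind_pmf M K)"
  using assms
proof (induction t1 arbitrary: c1 s M)
  case 0
  then have "map_pmf (Pair Skip) M = return_pmf (c1, s)"
    by (simp add: computes_def)
  then have "c1 = Skip" "M = return_pmf s"
    by (simp_all add: map_Pair_Skip_eq_return)
  moreover from this have "computes c2 s t2 (K s)"
    using 0 by simp
  ultimately show ?case
    by (simp add: computes_def bind_return_pmf)
next
  case (Suc t1)
  show ?case
  proof (cases "c1 = Skip")
    case True
    then have "map_pmf (Pair Skip) M = return_pmf (Skip, s)"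
      using Suc.prems(1) by (simp only: computes_def exec_Skip)
    then have M: "M = return_pmf s"
      by (simp add: map_Pair_Skip_eq_return)
    then have "computes c2 s (Suc t1 + t2) (K s)"
      using Suc.prems(2)[of s] by (simp add: computes_mono[of c2 s t2])
    then show ?thesis
      by (simp add: computes_def True M bind_return_pmf)
  next
    case False
    define D where "D = step n r f c1 s"
    \<comment> \<open>Forgetting the program component loses nothing: every \<open>t1\<close>-step
      path from a support point of \<open>D\<close> continues a path of \<open>c1\<close> and has
      therefore reached \<open>Skip\<close>.\<close>
    define M' where "M' = (\<lambda>cs. map_pmf snd (exec t1 cs))"
    have *: "bind_pmf D (exec t1) = map_pmf (Pair Skip) M"
      using Suc.prems(1) by (simp add: computes_def D_def)
    have M: "M = bind_pmf D M'"
    proof -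
      have "M = map_pmf snd (map_pmf (Pair Skip) M)"
        by (simp add: pmf.map_comp o_def)
      then show ?thesis
        by (simp add: *[symmetric] map_bind_pmf M'_def)
    qed
    have "computes (Seq c' c2) s' (t1 + t2 + 1) (bind_pmf (M' (c', s')) K)"
      if "(c', s') \<in> set_pmf D" for c' s'
    proof (rule Suc.IH)
      have "fst cs = Skip" if "cs \<in> set_pmf (exec t1 (c', s'))" for cs
      proof -
        have "cs \<in> set_pmf (bind_pmf D (exec t1))"
          using that \<open>(c', s') \<in> set_pmf D\<close> by auto
        then show ?thesis
          by (auto simp: *)
      qed
      then have "map_pmf (Pair Skip \<circ> snd) (exec t1 (c', s')) = map_pmf id (exec t1 (c', s'))"
        by (intro map_pmf_cong) (auto simp: prod_eq_iff)
      then show "computes c' s' t1 (M' (c', s'))"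
        by (simp add: computes_def M'_def pmf.map_comp)
      show "computes c2 s'' t2 (K s'')" if "s'' \<in> set_pmf (M' (c', s'))" for s''
        using that \<open>(c', s') \<in> set_pmf D\<close> by (intro Suc.prems(2)) (auto simp: M)
    qed
    then have "bind_pmf D (\<lambda>cs. exec (Suc (t1 + t2)) (Seq (fst cs) c2, snd cs)) =
        bind_pmf D (\<lambda>cs. map_pmf (Pair Skip) (bind_pmf (M' cs) K))"
      by (intro bind_pmf_cong) (auto simp: computes_def)
    then show ?thesis
      by (simp add: computes_def False M D_def[symmetric] bind_map_pmf case_prod_beta
          map_bind_pmf bind_assoc_pmf)
  qed
qed

lemma computes_Seq_det:
  assumes "computes c1 s t1 (return_pmf s')" "computes c2 s' t2 M"
  shows "computes (Seq c1 c2) s (t1 + t2 + 1) M"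
  using computes_Seq[OF assms(1), of c2 t2 "\<lambda>_. M"] assms(2) by (simp add: bind_return_pmf)

lemma computes_Cond:
  assumes "computes (if bval n r b s then c1 else c2) s t M"
  shows "computes (Cond b c1 c2) s (t + 1) M"
  using assms by (simp add: computes_def bind_return_pmf)

lemma computes_While:
  assumes "computes (if bval n r b s then Seq c (While b c) else Skip) s t M"
  shows "computes (While b c) s (t + 1) M"
  using assms by (simp add: computes_def bind_return_pmf)

section \<open>Straight-line programs and counting loops\<close>

primrec straight :: "com \<Rightarrow> bool" where
  "straight Skip = True"
| "straight (NSet x i e) = True"
| "straight (RSet x i e) = True"
| "straight (Query x i a) = True"
| "straight (Flip x i p) = False"
| "straight (Seq c1 c2) = (straight c1 \<and> straight c2)"
| "straight (Cond b c1 c2) = (straight c1 \<and> straight c2)"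
| "straight (While b c) = False"

primrec effect :: "com \<Rightarrow> state \<Rightarrow> state" where
  "effect Skip s = s"
| "effect (NSet x i e) s = set_nat x (nval n i s) (nval n e s) s"
| "effect (RSet x i e) s = set_real x (nval n i s) (rval n e s) s"
| "effect (Query x i a) s = set_real x (nval n i s) (f (stored_set n a s)) s"
| "effect (Flip x i p) s = s"
| "effect (Seq c1 c2) s = effect c2 (effect c1 s)"
| "effect (Cond b c1 c2) s = (if bval n r b s then effect c1 s else effect c2 s)"
| "effect (While b c) s = s"

text \<open>An upper bound: \<open>Cond\<close> is charged for its dearer branch, so that the count
  does not depend on the state.\<close>

primrec cost :: "com \<Rightarrow> nat" where
  "cost Skip = 0"
| "cost (NSet x i e) = 1"
| "cost (RSet x i e) = 1"
| "cost (Query x i a) = 1"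
| "cost (Flip x i p) = 1"
| "cost (Seq c1 c2) = cost c1 + cost c2 + 1"
| "cost (Cond b c1 c2) = max (cost c1) (cost c2) + 1"
| "cost (While b c) = 0"

lemma computes_straight:
  "straight c \<Longrightarrow> computes c s (cost c) (return_pmf (effect c s))"
proof (induction c arbitrary: s)
  case (Seq c1 c2)
  then show ?case
    using computes_Seq_det[of c1 s "cost c1" "effect c1 s" c2 "cost c2"] by simp
next
  case (Cond b c1 c2)
  have "computes (if bval n r b s then c1 else c2) s (max (cost c1) (cost c2))
      (return_pmf (effect (Cond b c1 c2) s))"
    using Cond computes_mono[OF _ max.cobounded1] computes_mono[OF _ max.cobounded2] by simp
  then show ?case
    using computes_Cond by simp
qed (simp_all add: computes_Skip computes_step[unfolded One_nat_def])

text \<open>Induction on the distance of the counter from \<open>n\<close>. Besides the body, an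
  iteration spends one step on unfolding \<open>While\<close> and one on leaving the
  \<open>Seq\<close>; the final \<open>+ 1\<close> is the failing test.\<close>

lemma computes_for_loop:
  fixes k :: nat and body :: com
  defines "loop \<equiv> While (NLess (NGet k (Num 0)) Size) body"
  assumes body: "straight body"
    and invariant: "\<And>s. I s \<Longrightarrow> nats s k 0 < n \<Longrightarrow> I (effect body s)"
    and counter: "\<And>s. nats (effect body s) k 0 = Suc (nats s k 0)"
    and "I s"
  shows "\<exists>s'. computes loop s ((n - nats s k 0) * (cost body + 2) + 1) (return_pmf s') \<and>
    I s' \<and> n \<le> nats s' k 0"
  using \<open>I s\<close>
proof (induction "n - nats s k 0" arbitrary: s)
  case 0
  then have "computes loop s (0 + 1) (return_pmf s)"
    unfolding loop_def by (intro computes_While) (simp add: computes_Skip)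
  with 0 show ?case by auto
next
  case (Suc m)
  let ?s = "effect body s"
  have less: "nats s k 0 < n"
    using Suc.hyps(2) by linarith
  have m: "m = n - nats ?s k 0"
    using Suc.hyps(2) by (simp add: counter)
  obtain s' where s': "computes loop ?s (m * (cost body + 2) + 1) (return_pmf s')"
      "I s'" "n \<le> nats s' k 0"
    using Suc.hyps(1)[OF m] invariant[OF Suc.prems less] m by auto
  have "computes (Seq body loop) s (cost body + (m * (cost body + 2) + 1) + 1) (return_pmf s')"
    using computes_Seq_det[OF computes_straight[OF body] s'(1)] .
  then have "computes loop s (cost body + (m * (cost body + 2) + 1) + 1 + 1) (return_pmf s')"
    unfolding loop_def using less by (intro computes_While) simp
  then have "computes loop s (Suc m * (cost body + 2) + 1) (return_pmf s')"
    by (simp add: algebra_simps)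
  then show ?case
    using s' by (auto simp: Suc.hyps(2)[symmetric])
qed

end

section \<open>The double greedy program\<close>

primrec block :: "com list \<Rightarrow> com" where
  "block [] = Skip"
| "block (c # cs) = Seq c (block cs)"

abbreviation var :: "nat \<Rightarrow> nexp" where
  "var k \<equiv> NGet k (Num 0)"

abbreviation increment :: "nat \<Rightarrow> com" where
  "increment k \<equiv> NSet k (Num 0) (NAdd (var k) (Num 1))"

abbreviation for_loop :: "nat \<Rightarrow> com \<Rightarrow> com" where
  "for_loop k c \<equiv> While (NLess (var k) Size) c"

text \<open>
  The arrays 0 and 1 hold the characteristic vectors of \<open>X\<close> and \<open>Y\<close>. The scalar 2 is the
  counter of the main loop, 3 that of the inner loops, 4 and 5 are the candidates \<open>u\<close> and \<open>v\<close>,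
  and 6 is the coin.
\<close>

definition undecided :: "nexp \<Rightarrow> bexp" where
  "undecided e = NLess (NGet 0 e) (NGet 1 e)"

definition fill_body :: com where
  "fill_body = block [NSet 1 (var 3) (Num 1), increment 3]"

definition start_scan :: com where
  "start_scan = block [NSet 4 (Num 0) (var 2), NSet 5 (Num 0) (var 2), NSet 3 (Num 0) (Num 0)]"

definition scan_body :: com where
  "scan_body = block
    [Cond (Conj (undecided (var 3)) (Below (var 3) (var 4))) (NSet 4 (Num 0) (var 3)) Skip,
     Cond (Conj (undecided (var 3)) (Below (var 5) (var 3))) (NSet 5 (Num 0) (var 3)) Skip,
     increment 3]"

text \<open>Both moves are made tentatively: afterwards array 0 holds \<open>X + u\<close> and array
  1 holds \<open>Y - v\<close>, while the real scalars 0 and 1 hold \<open>a\<close> and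
  \<open>max b 0\<close>.\<close>

definition probe :: com where
  "probe = block
    [Query 0 (Num 0) 0, NSet 0 (var 4) (Num 1), Query 1 (Num 0) 0,
     Query 2 (Num 0) 1, NSet 1 (var 5) (Num 0), Query 3 (Num 0) 1,
     RSet 0 (Num 0) (RSub (RGet 1 (Num 0)) (RGet 0 (Num 0))),
     RSet 1 (Num 0) (RSub (RGet 3 (Num 0)) (RGet 2 (Num 0))),
     Cond (RLess (RGet 1 (Num 0)) (RNum 0)) (RSet 1 (Num 0) (RNum 0)) Skip]"

text \<open>Only \<open>b\<close> is truncated: if \<open>a\<close> is negative, then
  \<open>a + b >= 0\<close> makes the quotient at most 0, which the coin clamps to bias 0.\<close>

definition toss :: com where
  "toss = Flip 6 (Num 0) (RDiv (RGet 0 (Num 0)) (RAdd (RGet 0 (Num 0)) (RGet 1 (Num 0))))"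

text \<open>Writing the coin into both cells replaces a branch: heads keeps \<open>u\<close> and
  puts \<open>v\<close> back, tails takes \<open>u\<close> out again and leaves \<open>v\<close>
  removed.\<close>

definition decide :: com where
  "decide = block [NSet 0 (var 4) (var 6), NSet 1 (var 5) (var 6)]"

definition greedy_round :: com where
  "greedy_round =
    Seq start_scan (Seq (for_loop 3 scan_body) (Seq probe (Seq toss decide)))"

text \<open>A round may settle elements other than the one at the counter, so the counter waits
  until its own element is decided. Decided elements stay decided, hence all those before the
  counter are.\<close>

definition main_loop :: com where
  "main_loop = for_loop 2 (Cond (undecided (var 2)) greedy_round (increment 2))"

definition double_greedy :: com where
  "double_greedy = Seq (for_loop 3 fill_body) main_loop"

lemma stored_set_indicator:
  assumes "nats s a = indicator A" "A \<subseteq> {..<n}"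
  shows "stored_set n a s = A"
  using assms by (auto simp: stored_set_def indicator_def)

lemma indicator_insert_upd: "(indicator A :: nat \<Rightarrow> nat)(u := Suc 0) = indicator (insert u A)"
  by (auto simp: indicator_def)

lemma indicator_remove_upd: "(indicator A :: nat \<Rightarrow> nat)(u := 0) = indicator (A - {u})"
  by (auto simp: indicator_def)

section \<open>Analysis of the scan, the round and the main loop\<close>

locale double_greedy_instance = oracle_machine +
  assumes order: "partial_order_on {..<n} r"
    and nonneg: "\<And>S. S \<in> ideals {..<n} r \<Longrightarrow> 0 \<le> f S"
    and dr: "dr_submodular {..<n} r f"
begin

definition holds :: "nat set \<Rightarrow> nat set \<Rightarrow> nat \<Rightarrow> state \<Rightarrow> bool" where
  "holds X Y c s \<longleftrightarrow> nats s 0 = indicator X \<and> nats s 1 = indicator Y \<and> nats s 2 0 = c"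

text \<open>The candidates \<open>u\<close> and \<open>v\<close> are updated independently;
  comparing both with the start element \<open>c\<close> keeps \<open>u\<close> below
  \<open>v\<close> by transitivity.\<close>

definition scanned :: "nat set \<Rightarrow> nat set \<Rightarrow> nat \<Rightarrow> state \<Rightarrow> bool" where
  "scanned X Y c s \<longleftrightarrow> holds X Y c s \<and> nats s 4 0 \<in> Y - X \<and> nats s 5 0 \<in> Y - X \<and>
    (nats s 4 0, c) \<in> r \<and> (c, nats s 5 0) \<in> r \<and>
    (\<forall>j \<in> Y - X. j < nats s 3 0 \<longrightarrow>
      ((j, nats s 4 0) \<in> r \<longrightarrow> j = nats s 4 0) \<and> ((nats s 5 0, j) \<in> r \<longrightarrow> j = nats s 5 0))"

lemmas state_simps = set_nat_def set_real_def undecided_def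

text \<open>Let \<open>i\<close> replace \<open>u\<close>. An earlier \<open>j\<close> below
  \<open>i\<close> is below \<open>u\<close>, hence equals \<open>u\<close> by the invariant, hence
  equals \<open>i\<close> by antisymmetry. The argument for \<open>v\<close> is dual.\<close>

lemma scan_invariant:
  assumes "scanned X Y c s" "nats s 3 0 < n"
  shows "scanned X Y c (effect scan_body s)"
proof -
  let ?i = "nats s 3 0" and ?u = "nats s 4 0" and ?v = "nats s 5 0"
  let ?s = "effect scan_body s"
  have undecided: "nats s 0 j < nats s 1 j \<longleftrightarrow> j \<in> Y - X" for j
    using assms(1) by (auto simp: scanned_def holds_def indicator_def)
  have eff: "nats ?s 0 = nats s 0" "nats ?s 1 = nats s 1" "nats ?s 2 = nats s 2"
    "nats ?s 3 0 = Suc ?i"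
    "nats ?s 4 0 = (if ?i \<in> Y - X \<and> (?i, ?u) \<in> r then ?i else ?u)"
    "nats ?s 5 0 = (if ?i \<in> Y - X \<and> (?v, ?i) \<in> r then ?i else ?v)"
    unfolding undecided[symmetric] by (simp_all add: scan_body_def state_simps) blast+
  define u where "u = nats ?s 4 0"
  define v where "v = nats ?s 5 0"
  note po = partial_order_onD[OF order]
  have old: "?u \<in> Y - X" "?v \<in> Y - X" "(?u, c) \<in> r" "(c, ?v) \<in> r"
    "\<And>j. j \<in> Y - X \<Longrightarrow> j < ?i \<Longrightarrow> (j, ?u) \<in> r \<Longrightarrow> j = ?u"
    "\<And>j. j \<in> Y - X \<Longrightarrow> j < ?i \<Longrightarrow> (?v, j) \<in> r \<Longrightarrow> j = ?v"
    using assms(1) by (auto simp: scanned_def)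
  have "u \<in> Y - X" "v \<in> Y - X" "(u, c) \<in> r" "(c, v) \<in> r"
    using old(1-4) po(2) unfolding u_def v_def eff by (auto split: if_split)
  moreover have "j = u" if "j \<in> Y - X" "j < Suc ?i" "(j, u) \<in> r" for j
  proof (cases "?i \<in> Y - X \<and> (?i, ?u) \<in> r")
    case True
    then have "u = ?i"
      by (simp add: u_def eff)
    then show ?thesis
      using that True old(5)[of j] po(2)[of j ?i ?u] po(3)[of j ?i] by (auto simp: less_Suc_eq)
  next
    case False
    then have "u = ?u"
      by (auto simp: u_def eff)
    then show ?thesis
      using that False old(5)[of j] by (auto simp: less_Suc_eq)
  qed
  moreover have "j = v" if "j \<in> Y - X" "j < Suc ?i" "(v, j) \<in> r" for j
  proof (cases "?i \<in> Y - X \<and> (?v, ?i) \<in> r")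
    case True
    then have "v = ?i"
      by (simp add: v_def eff)
    then show ?thesis
      using that True old(6)[of j] po(2)[of ?v ?i j] po(3)[of j ?i] by (auto simp: less_Suc_eq)
  next
    case False
    then have "v = ?v"
      by (auto simp: v_def eff)
    then show ?thesis
      using that False old(6)[of j] by (auto simp: less_Suc_eq)
  qed
  moreover have "holds X Y c ?s"
    using assms(1) unfolding scanned_def holds_def eff(1-3) by blast
  ultimately show ?thesis
    unfolding scanned_def u_def[symmetric] v_def[symmetric] eff(4) by blast
qed

lemma scan:
  assumes "holds X Y c s" "c \<in> Y - X" "X \<subseteq> {..<n}" "Y \<subseteq> {..<n}"
  shows "\<exists>s'. computes (for_loop 3 scan_body) (effect start_scan s)
      (n * (cost scan_body + 2) + 1) (return_pmf s') \<and> scanned X Y c s' \<and> n \<le> nats s' 3 0"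
proof -
  have start: "scanned X Y c (effect start_scan s)" "nats (effect start_scan s) 3 0 = 0"
    using assms partial_order_onD(1)[OF order, of c]
    by (auto simp: start_scan_def state_simps scanned_def holds_def)
  have "straight scan_body"
    by (simp add: scan_body_def)
  moreover have "nats (effect scan_body s) 3 0 = Suc (nats s 3 0)" for s
    by (simp add: scan_body_def state_simps)
  ultimately show ?thesis
    using computes_for_loop[of scan_body "scanned X Y c" 3, OF _ scan_invariant _ start(1)]
    by (simp add: start(2))
qed

text \<open>The 5 is the coin flip plus the four sequencing steps of
  \<open>greedy_round\<close>.\<close>

definition round_time :: nat where
  "round_time = cost start_scan + (n * (cost scan_body + 2) + 1) + cost probe + cost decide + 5"

lemma greedy_round:
  assumes "holds X Y c s" "c \<in> Y - X" "X \<subseteq> {..<n}" "Y \<subseteq> {..<n}"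
  shows "\<exists>u v h. u \<in> Y - X \<and> v \<in> Y - X \<and> (u, v) \<in> r \<and>
    (\<forall>j \<in> Y - X. ((j, u) \<in> r \<longrightarrow> j = u) \<and> ((v, j) \<in> r \<longrightarrow> j = v)) \<and>
    holds (insert u X) Y c (h True) \<and> holds X (Y - {v}) c (h False) \<and>
    computes greedy_round s round_time
      (map_pmf h (bernoulli_pmf ((f (insert u X) - f X) /
        (f (insert u X) - f X + max (f (Y - {v}) - f Y) 0))))"
proof -
  obtain s1 where s1: "computes (for_loop 3 scan_body) (effect start_scan s)
      (n * (cost scan_body + 2) + 1) (return_pmf s1)"
      "scanned X Y c s1" "n \<le> nats s1 3 0"
    using scan[OF assms] by blast
  define u where "u = nats s1 4 0"
  define v where "v = nats s1 5 0"
  \<comment> \<open>The scan has passed all of \<open>{..<n}\<close>, which contains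
    \<open>Y\<close>, so extremality among the scanned elements is extremality in
    \<open>Y - X\<close>.\<close>
  have uv: "u \<in> Y - X" "v \<in> Y - X" "(u, v) \<in> r"
    "\<And>j. j \<in> Y - X \<Longrightarrow> ((j, u) \<in> r \<longrightarrow> j = u) \<and> ((v, j) \<in> r \<longrightarrow> j = v)"
    using s1(2,3) assms(4) partial_order_onD(2)[OF order]
    by (auto simp: scanned_def u_def v_def)
  define s2 where "s2 = effect probe s1"
  define h where "h b = effect decide (set_nat 6 0 (if b then 1 else 0) s2)" for b :: bool
  define q where "q = (f (insert u X) - f X) /
        (f (insert u X) - f X + max (f (Y - {v}) - f Y) 0)"
  have XY: "nats s1 0 = indicator X" "nats s1 1 = indicator Y" "nats s1 2 0 = c"
    using s1(2) by (auto simp: scanned_def holds_def)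
  note XY = XY XY(2)[unfolded One_nat_def]
  have bounds: "X \<subseteq> {..<n}" "Y \<subseteq> {..<n}" "insert u X \<subseteq> {..<n}" "Y - {v} \<subseteq> {..<n}"
    using assms(3,4) uv by auto
  have nats_s2: "nats s2 0 = indicator (insert u X)" "nats s2 1 = indicator (Y - {v})"
    "nats s2 2 0 = c" "nats s2 4 0 = u" "nats s2 5 0 = v"
    by (simp_all add: s2_def probe_def state_simps XY u_def[symmetric] v_def[symmetric]
        indicator_insert_upd indicator_remove_upd)
  note nats_s2 = nats_s2 nats_s2(2)[unfolded One_nat_def]
  have reals_s2: "reals s2 0 0 = f (insert u X) - f X" "reals s2 1 0 = max (f (Y - {v}) - f Y) 0"
    by (simp_all add: s2_def probe_def state_simps XY u_def[symmetric] v_def[symmetric]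
        indicator_insert_upd indicator_remove_upd bounds[THEN stored_set_indicator[rotated]])
  note reals_s2 = reals_s2 reals_s2(2)[unfolded One_nat_def]
  have h: "holds (insert u X) Y c (h True)" "holds X (Y - {v}) c (h False)"
    using uv by (auto simp: holds_def h_def decide_def state_simps nats_s2
        indicator_insert_upd indicator_remove_upd insert_absorb)
  have "computes toss s2 1 (map_pmf (\<lambda>b. set_nat 6 0 (if b then 1 else 0) s2) (bernoulli_pmf q))"
    by (rule computes_step) (simp add: toss_def reals_s2 q_def pmf.map_comp o_def)
  then have "computes (Seq toss decide) s2 (1 + cost decide + 1)
      (bind_pmf (map_pmf (\<lambda>b. set_nat 6 0 (if b then 1 else 0) s2) (bernoulli_pmf q))
        (\<lambda>s. return_pmf (effect decide s)))"
    by (rule computes_Seq) (rule computes_straight, simp add: decide_def)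
  then have "computes (Seq toss decide) s2 (1 + cost decide + 1) (map_pmf h (bernoulli_pmf q))"
    by (simp add: h_def[abs_def] map_pmf_def[symmetric] pmf.map_comp o_def)
  then have "computes greedy_round s (cost start_scan + ((n * (cost scan_body + 2) + 1) +
      (cost probe + (1 + cost decide + 1) + 1) + 1) + 1) (map_pmf h (bernoulli_pmf q))"
    unfolding greedy_round_def s2_def
    by (intro computes_Seq_det[OF computes_straight] computes_Seq_det[OF s1(1)])
      (simp_all add: start_scan_def probe_def)
  then have "computes greedy_round s round_time (map_pmf h (bernoulli_pmf q))"
    by (rule computes_mono) (simp add: round_time_def)
  then show ?thesis
    using uv h unfolding q_def by blast
qed

text \<open>Induction on \<open>m\<close>: each iteration shrinks \<open>Y - X\<close> or advances
  the counter. \<open>T\<close> is arbitrary, so that the hypothesis applies with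
  \<open>insert u T\<close> on heads and \<open>T - {v}\<close> on tails. At the end
  \<open>X = T = Y\<close>, where the potential is \<open>4 * f X\<close>.\<close>

lemma main_loop:
  assumes "holds X Y c s" "X \<in> ideals {..<n} r" "Y \<in> ideals {..<n} r" "T \<in> ideals {..<n} r"
    and "X \<subseteq> T" "T \<subseteq> Y" "\<And>j. j < c \<Longrightarrow> j \<notin> Y - X" "card (Y - X) + (n - c) \<le> m"
  shows "\<exists>M. computes main_loop s (m * (round_time + 3) + 1) M \<and> finite (set_pmf M) \<and>
    stored_set n 0 ` set_pmf M \<subseteq> ideals {..<n} r \<and>
    potential f X Y T \<le> 4 * measure_pmf.expectation M (\<lambda>s. f (stored_set n 0 s))"
  using assms
proof (induction m arbitrary: X Y T c s)
  case (0 X Y T c s)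
  then have "n \<le> c" and Y: "Y \<subseteq> {..<n}"
    by (auto simp: ideals_def)
  then have "Y - X = {}"
    using 0 by (auto simp: subset_iff)
  then have eq: "Y = X" "T = X"
    using 0 by auto
  have out: "stored_set n 0 s = X"
    using 0 Y eq by (intro stored_set_indicator) (auto simp: holds_def)
  have "computes main_loop s (0 + 1) (return_pmf s)"
    unfolding main_loop_def using 0 \<open>n \<le> c\<close>
    by (intro computes_While) (simp add: holds_def computes_Skip)
  then show ?case
    using 0 out eq by (intro exI[of _ "return_pmf s"]) (simp add: potential_def)
next
  case (Suc m X Y T c s)
  have subsets: "X \<subseteq> {..<n}" "Y \<subseteq> {..<n}"
    using Suc.prems by (auto simp: ideals_def)
  then have fin: "finite (Y - X)"
    using finite_subset by blast
  have undecided: "bval n r (undecided (var 2)) s \<longleftrightarrow> c \<in> Y - X"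
    using Suc.prems(1) by (auto simp: holds_def undecided_def indicator_def)
  let ?body = "Cond (undecided (var 2)) greedy_round (increment 2)"
  \<comment> \<open>The 3 in \<open>round_time + 3\<close> pays for the \<open>While\<close> test,
    the \<open>Cond\<close> and leaving the \<open>Seq\<close>.\<close>
  have iterate: "computes main_loop s (Suc m * (round_time + 3) + 1) (bind_pmf M K)"
    if "c < n" "computes (if c \<in> Y - X then greedy_round else increment 2) s round_time M"
      "\<And>s'. s' \<in> set_pmf M \<Longrightarrow> computes main_loop s' (m * (round_time + 3) + 1) (K s')" for M K
  proof -
    have "computes ?body s (round_time + 1) M"
      using that(2) by (intro computes_Cond) (simp only: undecided)
    then have "computes (Seq ?body main_loop) s
        ((round_time + 1) + (m * (round_time + 3) + 1) + 1) (bind_pmf M K)"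
      using that(3) by (rule computes_Seq)
    then have "computes main_loop s
        ((round_time + 1) + (m * (round_time + 3) + 1) + 1 + 1) (bind_pmf M K)"
      unfolding main_loop_def using Suc.prems(1) \<open>c < n\<close>
      by (intro computes_While) (simp add: holds_def)
    then show ?thesis
      by (rule computes_mono) (simp add: algebra_simps)
  qed
  consider "n \<le> c" | "c < n" "c \<notin> Y - X" | "c < n" "c \<in> Y - X"
    by linarith
  then show ?case
  proof cases
    case 1
    \<comment> \<open>No element is left undecided, so the measure is 0 and the hypothesis applies
      to the same state.\<close>
    then have "Y - X = {}"
      using Suc.prems(7) subsets by (auto simp: subset_iff)
    then have "card (Y - X) + (n - c) \<le> m"
      using 1 by (simp only: card.empty)
    from Suc.IH[OF Suc.prems(1-7) this] show ?thesis
      using computes_mono[of main_loop s "m * (round_time + 3) + 1" _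
          "Suc m * (round_time + 3) + 1"] by auto
  next
    case 2
    let ?s = "effect (increment 2) s"
    have "holds X Y (Suc c) ?s"
      using Suc.prems(1) by (simp add: holds_def state_simps)
    moreover have "j \<notin> Y - X" if "j < Suc c" for j
      using that 2 Suc.prems(7) by (auto simp: less_Suc_eq)
    moreover have "card (Y - X) + (n - Suc c) \<le> m"
      using Suc.prems(8) 2 by linarith
    ultimately obtain M where M: "computes main_loop ?s (m * (round_time + 3) + 1) M"
        "finite (set_pmf M)" "stored_set n 0 ` set_pmf M \<subseteq> ideals {..<n} r"
        "potential f X Y T \<le> 4 * measure_pmf.expectation M (\<lambda>s. f (stored_set n 0 s))"
      using Suc.IH[OF _ Suc.prems(2-6)] by blast
    have "computes (increment 2) s round_time (return_pmf ?s)"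
      by (rule computes_mono[OF computes_straight]) (simp_all add: round_time_def)
    then have "computes main_loop s (Suc m * (round_time + 3) + 1) (bind_pmf (return_pmf ?s) (\<lambda>_. M))"
      using 2 M(1) by (intro iterate) (simp_all only: if_False set_return_pmf singleton_iff)
    then show ?thesis
      using M by (auto simp: bind_return_pmf)
  next
    case 3
    obtain u v h where uv: "u \<in> Y - X" "v \<in> Y - X" "(u, v) \<in> r"
      and minimal: "\<And>j. j \<in> Y - X \<Longrightarrow> (j, u) \<in> r \<Longrightarrow> j = u"
      and maximal: "\<And>j. j \<in> Y - X \<Longrightarrow> (v, j) \<in> r \<Longrightarrow> j = v"
      and h: "holds (insert u X) Y c (h True)" "holds X (Y - {v}) c (h False)"
      and round: "computes greedy_round s round_time
        (map_pmf h (bernoulli_pmf ((f (insert u X) - f X) /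
          (f (insert u X) - f X + max (f (Y - {v}) - f Y) 0))))"
      using greedy_round[OF Suc.prems(1) 3(2) subsets] by blast
    define q where "q = (f (insert u X) - f X) /
          (f (insert u X) - f X + max (f (Y - {v}) - f Y) 0)"
    let ?E = "\<lambda>M. measure_pmf.expectation M (\<lambda>s. f (stored_set n 0 s))"
    have ideal: "insert u X \<in> ideals {..<n} r" "insert u T \<in> ideals {..<n} r"
        "Y - {v} \<in> ideals {..<n} r" "T - {v} \<in> ideals {..<n} r"
      using ideals_insert_minimal[OF Suc.prems(3) _ _ _ minimal]
        ideals_remove_maximal[OF Suc.prems(2) _ _ uv(2) maximal] Suc.prems uv by blast+
    have diff: "Y - insert u X = (Y - X) - {u}" "Y - {v} - X = (Y - X) - {v}"
      by auto
    have "card (Y - insert u X) + (n - c) \<le> m" "card (Y - {v} - X) + (n - c) \<le> m"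
      using Suc.prems(8) uv fin card_gt_0_iff[of "Y - X"]
      unfolding diff by (auto simp: card_Diff_singleton)
    then obtain M1 M0 where
      M1: "computes main_loop (h True) (m * (round_time + 3) + 1) M1"
        "finite (set_pmf M1)" "stored_set n 0 ` set_pmf M1 \<subseteq> ideals {..<n} r"
        "potential f (insert u X) Y (insert u T) \<le> 4 * ?E M1" and
      M0: "computes main_loop (h False) (m * (round_time + 3) + 1) M0"
        "finite (set_pmf M0)" "stored_set n 0 ` set_pmf M0 \<subseteq> ideals {..<n} r"
        "potential f X (Y - {v}) (T - {v}) \<le> 4 * ?E M0"
      using Suc.IH[OF h(1) ideal(1) Suc.prems(3) ideal(2)]
        Suc.IH[OF h(2) Suc.prems(2) ideal(3,4)] Suc.prems(5-7) uv by blast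
    \<comment> \<open>\<open>computes_Seq\<close> takes the continuation as a function of the state,
      so the two coin outcomes must be told apart; they differ at cell \<open>u\<close> of array
      0.\<close>
    have distinct: "h True \<noteq> h False"
    proof
      assume "h True = h False"
      then have "(indicator (insert u X) u :: nat) = indicator X u"
        using h by (metis holds_def)
      then show False
        using uv by simp
    qed
    define K where "K s' = (if s' = h True then M1 else M0)" for s'
    define M where "M = bind_pmf (bernoulli_pmf q) (\<lambda>b. if b then M1 else M0)"
    have "(\<lambda>b. K (h b)) = (\<lambda>b. if b then M1 else M0)"
      using distinct by (auto simp: K_def fun_eq_iff split: bool.split)
    then have M_eq: "bind_pmf (map_pmf h (bernoulli_pmf q)) K = M"
      by (simp add: bind_map_pmf M_def)
    have "computes main_loop s (Suc m * (round_time + 3) + 1)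
        (bind_pmf (map_pmf h (bernoulli_pmf q)) K)"
    proof (rule iterate)
      show "computes (if c \<in> Y - X then greedy_round else increment 2) s round_time
          (map_pmf h (bernoulli_pmf q))"
        using round 3 by (simp add: q_def)
      fix s' assume "s' \<in> set_pmf (map_pmf h (bernoulli_pmf q))"
      then obtain b where "s' = h b"
        by auto
      then show "computes main_loop s' (m * (round_time + 3) + 1) (K s')"
        using M1(1) M0(1) distinct by (cases b) (auto simp: K_def)
    qed (use 3 in simp)
    then have "computes main_loop s (Suc m * (round_time + 3) + 1) M"
      by (simp only: M_eq)
    moreover have "finite (set_pmf M)" "stored_set n 0 ` set_pmf M \<subseteq> ideals {..<n} r"
      using M1(2,3) M0(2,3) by (auto simp: M_def image_subset_iff split: if_splits)
    moreover have "potential f X Y T \<le> 4 * ?E M"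
    proof -
      have "potential f X Y T \<le> clamp_unit q * potential f (insert u X) Y (insert u T) +
          (1 - clamp_unit q) * potential f X (Y - {v}) (T - {v})"
        unfolding q_def
        by (rule potential_step[OF dr Suc.prems(2-6) uv minimal maximal])
      also have "\<dots> \<le> clamp_unit q * (4 * ?E M1) + (1 - clamp_unit q) * (4 * ?E M0)"
        using M1(4) M0(4) clamp_unit_bounds[of q] by (intro add_mono mult_left_mono) auto
      also have "\<dots> = 4 * ?E M"
        unfolding M_def using M1(2) M0(2)
        by (subst expectation_bind_bernoulli) (auto simp: algebra_simps)
      finally show ?thesis .
    qed
    ultimately show ?thesis
      by blast
  qed
qed

section \<open>The full run and its guarantee\<close>

lemma fill_loop:
  "\<exists>s. computes (for_loop 3 fill_body) init_state (n * (cost fill_body + 2) + 1) (return_pmf s) \<and>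
    holds {} {..<n} 0 s"
proof -
  define I where "I s \<longleftrightarrow> nats s 0 = indicator {} \<and> nats s 1 = indicator {..<nats s 3 0} \<and>
    nats s 2 0 = 0 \<and> nats s 3 0 \<le> n" for s :: state
  have "straight fill_body"
    by (simp add: fill_body_def)
  moreover have "I (effect fill_body s)" if "I s" "nats s 3 0 < n" for s
    using that by (auto simp: I_def fill_body_def state_simps indicator_insert_upd lessThan_Suc)
  moreover have "nats (effect fill_body s) 3 0 = Suc (nats s 3 0)" for s
    by (simp add: fill_body_def state_simps)
  moreover have "I init_state"
    by (auto simp: I_def init_state_def indicator_def)
  ultimately obtain s where "computes (for_loop 3 fill_body) init_state
      ((n - nats init_state 3 0) * (cost fill_body + 2) + 1) (return_pmf s)" "I s" "n \<le> nats s 3 0"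
    using computes_for_loop[of fill_body I 3 init_state] by blast
  then show ?thesis
    by (auto simp: I_def holds_def init_state_def)
qed

lemma double_greedy:
  assumes "100 + 100 * n + 100 * n * n \<le> t"
  shows "halts_within n r f double_greedy t"
    and "set_pmf (output_pmf n r f double_greedy t) \<subseteq> ideals {..<n} r"
    and "measure_pmf.expectation (output_pmf n r f double_greedy t) f
      \<ge> 1 / 2 * Max (f ` ideals {..<n} r)"
proof -
  obtain s where s: "computes (for_loop 3 fill_body) init_state
      (n * (cost fill_body + 2) + 1) (return_pmf s)" "holds {} {..<n} 0 s"
    using fill_loop by blast
  have "Max (f ` ideals {..<n} r) \<in> f ` ideals {..<n} r"
    using finite_ideals[of "{..<n}" r] empty_in_ideals[of "{..<n}" r] by (intro Max_in) auto
  then obtain T where T: "T \<in> ideals {..<n} r" "Max (f ` ideals {..<n} r) = f T"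
    by auto
  then have "T \<subseteq> {..<n}"
    by (auto simp: ideals_def)
  \<comment> \<open>The \<open>2 * n\<close> counts \<open>n\<close> undecided elements and
    \<open>n\<close> advances of the counter.\<close>
  with T s(2) obtain M where M: "computes main_loop s ((2 * n) * (round_time + 3) + 1) M"
      "stored_set n 0 ` set_pmf M \<subseteq> ideals {..<n} r"
      "potential f {} {..<n} T \<le> 4 * measure_pmf.expectation M (\<lambda>s. f (stored_set n 0 s))"
    using main_loop[OF s(2) empty_in_ideals ground_in_ideals T(1), of "2 * n"] by auto
  have "computes double_greedy init_state
      ((n * (cost fill_body + 2) + 1) + ((2 * n) * (round_time + 3) + 1) + 1) M"
    unfolding double_greedy_def using s(1) M(1) by (rule computes_Seq_det)
  \<comment> \<open>With all costs expanded, the left side is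
    \<open>20 * n * n + 82 * n + 3\<close>.\<close>
  moreover have "(n * (cost fill_body + 2) + 1) + ((2 * n) * (round_time + 3) + 1) + 1 \<le> t"
    using assms by (simp add: round_time_def fill_body_def start_scan_def scan_body_def probe_def
        decide_def algebra_simps)
  ultimately have "computes double_greedy init_state t M"
    by (rule computes_mono)
  then have run: "run n r f double_greedy t = map_pmf (Pair Skip) M"
    by (simp add: run_eq_exec computes_def)
  then show "halts_within n r f double_greedy t"
    by (auto simp: halts_within_def)
  have out: "output_pmf n r f double_greedy t = map_pmf (stored_set n 0) M"
    by (simp add: output_pmf_def run pmf.map_comp o_def)
  show "set_pmf (output_pmf n r f double_greedy t) \<subseteq> ideals {..<n} r"
    using M(2) by (simp add: out)
  \<comment> \<open>Nonnegativity of \<open>f\<close> enters here: it discards the values at the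
    empty set and at the ground set.\<close>
  have "2 * f T \<le> potential f {} {..<n} T"
    using nonneg[OF empty_in_ideals] nonneg[OF ground_in_ideals] by (simp add: potential_def)
  then show "measure_pmf.expectation (output_pmf n r f double_greedy t) f
      \<ge> 1 / 2 * Max (f ` ideals {..<n} r)"
    using M(3) by (simp add: out T(2))
qed

end

theorem theorem10:
  shows "\<exists>(prog :: com) (p :: nat poly).
    \<forall>(n :: nat) (r :: (nat \<times> nat) set) (f :: nat set \<Rightarrow> real).
      partial_order_on {..<n} r \<and>
      (\<forall>S\<in>ideals {..<n} r. 0 \<le> f S) \<and>
      dr_submodular {..<n} r f \<longrightarrow>
        halts_within n r f prog (poly p n) \<and>
        set_pmf (output_pmf n r f prog (poly p n)) \<subseteq> ideals {..<n} r \<and>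
        measure_pmf.expectation (output_pmf n r f prog (poly p n)) f
          \<ge> 1 / 2 * Max (f ` ideals {..<n} r)"
proof (intro exI allI impI)
  fix n :: nat and r :: "(nat \<times> nat) set" and f :: "nat set \<Rightarrow> real"
  assume "partial_order_on {..<n} r \<and> (\<forall>S\<in>ideals {..<n} r. 0 \<le> f S) \<and>
    dr_submodular {..<n} r f"
  then interpret double_greedy_instance n r f
    by unfold_locales auto
  have "100 + 100 * n + 100 * n * n \<le> poly [:100, 100, 100:] n"
    by (simp add: algebra_simps)
  from double_greedy[OF this]
  show "halts_within n r f double_greedy (poly [:100, 100, 100:] n) \<and>
      set_pmf (output_pmf n r f double_greedy (poly [:100, 100, 100:] n)) \<subseteq> ideals {..<n} r \<and>
      measure_pmf.expectation (output_pmf n r f double_greedy (poly [:100, 100, 100:] n)) f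
        \<ge> 1 / 2 * Max (f ` ideals {..<n} r)"
    by blast
qed

end
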